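(* If $G$ is a graph of order $n$, then $\gamma_a(G\circ K_1)=\gamma(G\circ K_1)+1=n+1$.
   Context: All graphs are simple. The corona $G\circ K_1$ is obtained from $G$ by adding, for each vertex $v\in V(G)$, a new vertex $v'$ and the pendant edge $vv'$. A dominating set of a graph $H=(V,E)$ is a set $D\subseteq V$ such that every vertex not in $D$ is adjacent to some vertex of $D$; $\gamma(H)$ is the minimum cardinality of a dominating set. A dominating set $D$ is accurate if no $|D|$-element subset of $V\setminus D$ is a dominating set of $H$; $\gamma_a(H)$ is the minimum cardinality of an accurate dominating set. *)

theory Defs
  imports "Graph_Theory.Pair_Digraph"
begin

text \<open>
  A finite simple graph is a \<^locale>\<open>pair_graph\<close>: a finite, loop-free, symmetric digraph without
  parallel arcs, an edge being represented by its two opposite arcs. The definitions below are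
  meant for such graphs only.
\<close>

text \<open>
  The corona with a single vertex: \<^term>\<open>Inl v\<close> is the original vertex \<^term>\<open>v\<close> and
  \<^term>\<open>Inr v\<close> is the new leaf attached to it.
\<close>

definition corona_K1 :: "'a pair_pre_digraph \<Rightarrow> ('a + 'a) pair_pre_digraph" where
  "corona_K1 G = \<lparr>
     pverts = Inl ` pverts G \<union> Inr ` pverts G,
     parcs = {(Inl u, Inl v) | u v. (u, v) \<in> parcs G}
           \<union> {(Inl v, Inr v) | v. v \<in> pverts G}
           \<union> {(Inr v, Inl v) | v. v \<in> pverts G} \<rparr>"

definition dominating_set :: "'a pair_pre_digraph \<Rightarrow> 'a set \<Rightarrow> bool" where
  "dominating_set H D \<longleftrightarrow>
     D \<subseteq> pverts H \<and> (\<forall>v \<in> pverts H - D. \<exists>u \<in> D. (v, u) \<in> parcs H)"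

definition accurate_dominating_set :: "'a pair_pre_digraph \<Rightarrow> 'a set \<Rightarrow> bool" where
  "accurate_dominating_set H D \<longleftrightarrow>
     dominating_set H D \<and>
     \<not> (\<exists>S \<subseteq> pverts H - D. card S = card D \<and> dominating_set H S)"

definition domination_number :: "'a pair_pre_digraph \<Rightarrow> nat" where
  "domination_number H = (LEAST k. \<exists>D. dominating_set H D \<and> card D = k)"

text \<open>
  A graph with at least one vertex has an accurate dominating set, namely the whole vertex set
  (lemma \<open>accurate_dominating_set_pverts\<close>), so the minimum exists. The graph without vertices
  has none: its only vertex set is empty, and its complement is again empty and dominating.
\<close>

definition accurate_domination_number :: "'a pair_pre_digraph \<Rightarrow> nat" where
  "accurate_domination_number H = (LEAST k. \<exists>D. accurate_dominating_set H D \<and> card D = k)"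

lemma dominating_set_pverts: "dominating_set H (pverts H)"
  by (simp add: dominating_set_def)

lemma accurate_dominating_set_pverts:
  assumes "pair_graph H" and "pverts H \<noteq> {}"
  shows "accurate_dominating_set H (pverts H)"
proof -
  interpret pair_graph H by fact
  show ?thesis
    using assms(2) pair_finite_verts
    by (auto simp: accurate_dominating_set_def dominating_set_pverts)
qed

lemma pair_graph_corona_K1:
  assumes "pair_graph G"
  shows "pair_graph (corona_K1 G)"
proof -
  interpret pair_graph G by fact
  have *: "parcs (corona_K1 G) \<subseteq> pverts (corona_K1 G) \<times> pverts (corona_K1 G)"
    by (auto simp: corona_K1_def dest: in_arcsD1 in_arcsD2)
  have fin: "finite (pverts (corona_K1 G))"
    using pair_finite_verts by (simp add: corona_K1_def)
  have "finite (parcs (corona_K1 G))"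
    using * fin by (meson finite_SigmaI finite_subset)
  moreover have "(v, u) \<in> parcs G" if "(u, v) \<in> parcs G" for u v
    using that pair_sym_arcs by (auto simp: symmetric_def dest: symD)
  then have "symmetric (with_proj (corona_K1 G))"
    by (auto simp: symmetric_def corona_K1_def intro!: symI)
  moreover have "fst e \<noteq> snd e" if "e \<in> parcs (corona_K1 G)" for e
    using that pair_no_loops by (fastforce simp: corona_K1_def)
  ultimately show ?thesis
    using * fin by unfold_locales auto
qed

end

theory Submission
  imports Defs
begin

text \<open>
  A vertex set of the corona is dominating iff it meets every pair consisting of a vertex and its
  leaf: the leaf has no other neighbour, and the two are adjacent. Hence a dominating set of size
  \<open>n\<close> picks exactly one element of each pair, and its complement is again such a transversal,
  so it is not accurate. A dominating set of size \<open>n + 1\<close> is accurate since its complement has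
  only \<open>n - 1\<close> elements.
\<close>

lemma pverts_corona_K1: "pverts (corona_K1 G) = Inl ` pverts G \<union> Inr ` pverts G"
  by (simp add: corona_K1_def)

lemma dominating_set_corona_K1_iff:
  "dominating_set (corona_K1 G) D \<longleftrightarrow>
     D \<subseteq> pverts (corona_K1 G) \<and> (\<forall>v \<in> pverts G. Inl v \<in> D \<or> Inr v \<in> D)"
proof
  assume "dominating_set (corona_K1 G) D"
  then show "D \<subseteq> pverts (corona_K1 G) \<and> (\<forall>v \<in> pverts G. Inl v \<in> D \<or> Inr v \<in> D)"
    unfolding dominating_set_def corona_K1_def by fastforce
next
  assume "D \<subseteq> pverts (corona_K1 G) \<and> (\<forall>v \<in> pverts G. Inl v \<in> D \<or> Inr v \<in> D)"
  then show "dominating_set (corona_K1 G) D"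
    unfolding dominating_set_def corona_K1_def by auto
qed

lemma card_pverts_corona_K1:
  assumes "finite (pverts G)"
  shows "card (pverts (corona_K1 G)) = 2 * card (pverts G)"
  using assms unfolding pverts_corona_K1
  by (subst card_Un_disjoint) (auto simp: card_image)

text \<open>The map \<open>case_sum id id\<close> collapses each leaf onto its neighbour, so meeting
  every pair means surjectivity. This yields the lower bound on \<open>card D\<close>, and
  injectivity on \<open>D\<close> in the case of equality.\<close>

lemma image_dominating_set_corona_K1:
  assumes "dominating_set (corona_K1 G) D"
  shows "case_sum id id ` D = pverts G"
  using assms unfolding dominating_set_corona_K1_iff pverts_corona_K1 by force

text \<open>Since \<open>card\<close> is 0 on infinite sets, the counting arguments below need
  finiteness first.\<close>

lemma finite_dominating_set_corona_K1:
  assumes "finite (pverts G)" and "dominating_set (corona_K1 G) D"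
  shows "finite D"
  using assms unfolding dominating_set_def pverts_corona_K1
  by (meson finite_UnI finite_imageI finite_subset)

lemma card_dominating_set_corona_K1:
  assumes "finite (pverts G)" and "dominating_set (corona_K1 G) D"
  shows "card (pverts G) \<le> card D"
  using card_image_le[OF finite_dominating_set_corona_K1[OF assms], of "case_sum id id"]
    image_dominating_set_corona_K1[OF assms(2)] by simp

lemma domination_number_corona_K1:
  assumes "finite (pverts G)"
  shows "domination_number (corona_K1 G) = card (pverts G)"
  unfolding domination_number_def
proof (rule Least_equality)
  have "dominating_set (corona_K1 G) (Inl ` pverts G)"
    by (auto simp: dominating_set_corona_K1_iff pverts_corona_K1)
  then show "\<exists>D. dominating_set (corona_K1 G) D \<and> card D = card (pverts G)"
    by (metis card_image inj_Inl)
qed (auto intro: card_dominating_set_corona_K1[OF assms])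

lemma card_accurate_dominating_set_corona_K1:
  assumes fin: "finite (pverts G)" and acc: "accurate_dominating_set (corona_K1 G) D"
  shows "card (pverts G) < card D"
proof (rule ccontr)
  assume "\<not> card (pverts G) < card D"
  moreover have dom: "dominating_set (corona_K1 G) D"
    using acc by (simp add: accurate_dominating_set_def)
  ultimately have card: "card D = card (pverts G)"
    using card_dominating_set_corona_K1[OF fin dom] by simp
  have finD: "finite D" and sub: "D \<subseteq> pverts (corona_K1 G)"
    using finite_dominating_set_corona_K1[OF fin dom] dom by (auto simp: dominating_set_def)
  \<comment> \<open>A map from a finite set onto a set of the same size is injective.\<close>
  have inj: "inj_on (case_sum id id) D"
    using finD card image_dominating_set_corona_K1[OF dom] by (simp add: eq_card_imp_inj_on)
  let ?S = "pverts (corona_K1 G) - D"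
  \<comment> \<open>Both elements collapse to \<open>v\<close>. So \<open>D\<close> misses one
    element of each pair, and the complement contains it.\<close>
  have "\<not> (Inl v \<in> D \<and> Inr v \<in> D)" for v
    using inj_onD[OF inj, of "Inl v" "Inr v"] by auto
  then have "dominating_set (corona_K1 G) ?S"
    by (auto simp: dominating_set_corona_K1_iff pverts_corona_K1)
  moreover have "card ?S = card D"
    using card_Diff_subset[OF finD sub] card_pverts_corona_K1[OF fin] card by simp
  ultimately show False
    using acc unfolding accurate_dominating_set_def by blast
qed

lemma accurate_domination_number_corona_K1:
  assumes fin: "finite (pverts G)" and "pverts G \<noteq> {}"
  shows "accurate_domination_number (corona_K1 G) = card (pverts G) + 1"
  unfolding accurate_domination_number_def
proof (rule Least_equality)
  obtain w where w: "w \<in> pverts G"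
    using assms(2) by blast
  \<comment> \<open>All original vertices already dominate; one extra leaf tips the count beyond
    half of the corona.\<close>
  define D where "D = insert (Inr w) (Inl ` pverts G)"
  have dom: "dominating_set (corona_K1 G) D"
    using w by (auto simp: dominating_set_corona_K1_iff pverts_corona_K1 D_def)
  have card: "card D = card (pverts G) + 1"
    using fin by (auto simp: D_def card_insert_if card_image)
  have "pverts (corona_K1 G) - D \<subseteq> Inr ` (pverts G - {w})"
    by (auto simp: pverts_corona_K1 D_def)
  \<comment> \<open>This bound is one more than the true maximum, but still less than
    \<open>card D\<close>.\<close>
  then have "card S \<le> card (pverts G)" if "S \<subseteq> pverts (corona_K1 G) - D" for S
    using that fin by (intro surj_card_le[where f = Inr]) auto
  then have "accurate_dominating_set (corona_K1 G) D"
    using dom card unfolding accurate_dominating_set_def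
    by (metis Suc_eq_plus1 not_less_eq_eq order_refl)
  then show "\<exists>D. accurate_dominating_set (corona_K1 G) D \<and> card D = card (pverts G) + 1"
    using card by blast
\<comment> \<open>Minimality: over the naturals, the strict bound
  \<open>card (pverts G) < card D\<close> is the required
  \<open>card (pverts G) + 1 \<le> card D\<close>.\<close>
qed (auto dest: card_accurate_dominating_set_corona_K1[OF fin])

theorem theorem2p6:
  fixes G :: "'a pair_pre_digraph" and n :: nat
  assumes "pair_graph G"
    and "pverts G \<noteq> {}"
    and "card (pverts G) = n"
  shows "accurate_domination_number (corona_K1 G) = domination_number (corona_K1 G) + 1
       \<and> domination_number (corona_K1 G) + 1 = n + 1"
proof -
  interpret pair_graph G by fact
  show ?thesis
    using assms(2,3) pair_finite_verts
    by (simp add: domination_number_corona_K1 accurate_domination_number_corona_K1)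
qed

end
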